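(* Let $k$ and $t$ be positive integers and let $n = mt$ where every prime factor of the positive integer $m$ is greater than $k!/2$. Let $S \subseteq \mathbb{Z}_n \setminus \{0\}$ with $|S| = k$. Then $S$ is sequenceable in each of the following cases: (1) $k \leq 11$ and $t \leq 5$; (2) $k = 12$ and $t \leq 4$; (3) $k = 13$ and $t \in \{2,3\}$, provided $S$ contains at least one element not in the subgroup of $\mathbb{Z}_n$ of order $m$; (4) $k = 14$ and $t = 2$, provided $S$ contains at least one element not in the subgroup of $\mathbb{Z}_n$ of order $m$; (5) $k = 15$ and $t = 2$, provided the number of elements of $S$ lying in the subgroup of $\mathbb{Z}_n$ of order $m$ is not exactly $0$, $1$, $2$ or $15$.
   Context: $\mathbb{Z}_n$ denotes the additive cyclic group of order $n$. For a finite subset $S$ of an abelian group with $|S| = k$, an ordering $(x_1,\dots,x_k)$ of the elements of $S$ has partial sums $(y_0,y_1,\dots,y_k)$ where $y_0 = 0$ and $y_i = x_1 + \cdots + x_i$. The ordering is a (linear) sequencing if $y_0,\dots,y_k$ are pairwise distinct, and a rotational sequencing if they are pairwise distinct except that $y_k = y_0 = 0$. The set $S$ is sequenceable if it has a sequencing or a rotational sequencing. *)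

theory Defs
  imports "HOL-Computational_Algebra.Primes"
begin

text \<open>Z_n is modelled by the residues {0..<n} (type nat) with addition mod n.
  An ordering of a finite set S is a list xs with distinct xs and set xs = S.\<close>

definition partial_sums :: "nat \<Rightarrow> nat list \<Rightarrow> nat list" where
  "partial_sums n xs = map (\<lambda>i. sum_list (take i xs) mod n) [0..<Suc (length xs)]"

definition is_sequencing :: "nat \<Rightarrow> nat set \<Rightarrow> nat list \<Rightarrow> bool" where
  "is_sequencing n S xs \<longleftrightarrow>
     distinct xs \<and> set xs = S \<and> distinct (partial_sums n xs)"

definition is_rotational_sequencing :: "nat \<Rightarrow> nat set \<Rightarrow> nat list \<Rightarrow> bool" where
  "is_rotational_sequencing n S xs \<longleftrightarrow>
     distinct xs \<and> set xs = S \<and> distinct (butlast (partial_sums n xs))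
     \<and> last (partial_sums n xs) = 0"

definition sequenceable :: "nat \<Rightarrow> nat set \<Rightarrow> bool" where
  "sequenceable n S \<longleftrightarrow>
     (\<exists>xs. is_sequencing n S xs \<or> is_rotational_sequencing n S xs)"

definition subgroup_of_order :: "nat \<Rightarrow> nat \<Rightarrow> nat set" where
  "subgroup_of_order n m = {x. x < n \<and> (m * x) mod n = 0}"

end

theory Submission
  imports Defs "Jordan_Normal_Form.Determinant"
begin

text \<open>For k at most 3 a short case analysis suffices. Otherwise m and t are coprime, so Z_n is
  Z_m times Z_t. A nonzero minor d of a 0/1 matrix with at most k rows satisfies 2 |d| \<le> k!, hence is
  invertible modulo m; by Cramer's rule the Z_m components lift to integers z that satisfy every
  subset-sum relation valid modulo m and still separate the elements. It remains to order a finite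
  subset of Z times Z_t, which works for every k: first the elements with z < 0, then those with
  z = 0, then those with z > 0. Only a block around the middle can sum to zero, and the two outer
  parts are ordered greedily from the outside, always taking the next element from the heavier side
  so that the rest does not sum to zero. If the middle part has sum zero in Z_t, one of its elements
  is moved to the far end of the heavier side. The middle part has at most t - 1 elements, and
  for t \<le> 5 it can be ordered by hand.\<close>

section \<open>Orderings in the product of the integers and a cyclic group\<close>

text \<open>\<open>z\<close> and \<open>h\<close> are the components in Z and in Z_t (the latter as an integer representative);
  \<open>w\<close> is an offset standing for the elements with \<open>z = 0\<close> between the two outer parts.\<close>

definition zero_block :: "('a \<Rightarrow> int) \<Rightarrow> ('a \<Rightarrow> int) \<Rightarrow> int \<Rightarrow> int \<Rightarrow> 'a list \<Rightarrow> bool" where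
  "zero_block z h t w ys \<longleftrightarrow> sum_list (map z ys) = 0 \<and> t dvd w + sum_list (map h ys)"

section \<open>Lists without zero-sum blocks\<close>

definition block_free :: "('a list \<Rightarrow> bool) \<Rightarrow> 'a list \<Rightarrow> bool" where
  "block_free N xs \<longleftrightarrow> (\<forall>as ys bs. xs = as @ ys @ bs \<longrightarrow> ys \<noteq> [] \<longrightarrow> \<not> N ys)"

text \<open>Sums of consecutive blocks are the differences of partial sums, so for the predicate
  "sum zero" this covers sequencings and rotational sequencings at once: the whole list is exempt
  because the last partial sum may return to the first. \<open>block_free\<close> is the linear
  case.\<close>

definition proper_block_free :: "('a list \<Rightarrow> bool) \<Rightarrow> 'a list \<Rightarrow> bool" where
  "proper_block_free N xs \<longleftrightarrow>
     (\<forall>as ys bs. xs = as @ ys @ bs \<longrightarrow> ys \<noteq> [] \<longrightarrow> as \<noteq> [] \<or> bs \<noteq> [] \<longrightarrow> \<not> N ys)"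

lemma block_free_iff: "block_free N xs \<longleftrightarrow> proper_block_free N xs \<and> (xs = [] \<or> \<not> N xs)"
proof (intro iffI conjI)
  assume *: "block_free N xs"
  then show "proper_block_free N xs" unfolding block_free_def proper_block_free_def by blast
  show "xs = [] \<or> \<not> N xs" using *[unfolded block_free_def, rule_format, of "[]" xs "[]"] by auto
next
  assume *: "proper_block_free N xs \<and> (xs = [] \<or> \<not> N xs)"
  show "block_free N xs" unfolding block_free_def
  proof (intro allI impI)
    fix as ys bs assume "xs = as @ ys @ bs" "ys \<noteq> []"
    then show "\<not> N ys" using * unfolding proper_block_free_def
      by (cases "as = [] \<and> bs = []") auto
  qed
qed

text \<open>A block lies in the left list, lies in the right list or straddles the junction. Only
  straddling blocks involve both lists, and these are left to the third premise.\<close>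

lemma proper_block_free_append:
  assumes "block_free N xs" "block_free N ys"
    and "\<And>as us vs bs. xs = as @ us \<Longrightarrow> ys = vs @ bs \<Longrightarrow> us \<noteq> [] \<Longrightarrow> vs \<noteq> [] \<Longrightarrow>
      as \<noteq> [] \<or> bs \<noteq> [] \<Longrightarrow> \<not> N (us @ vs)"
  shows "proper_block_free N (xs @ ys)"
  unfolding proper_block_free_def
proof (intro allI impI)
  fix as us bs assume *: "xs @ ys = as @ us @ bs" "us \<noteq> []" "as \<noteq> [] \<or> bs \<noteq> []"
  then consider cs where "xs = as @ cs" "cs @ ys = us @ bs" 
    | cs where "xs @ cs = as" "ys = cs @ us @ bs"
    by (auto simp: append_eq_append_conv2)
  then show "\<not> N us"
  proof cases
    case 1
    from 1(2) consider ds where "cs = us @ ds" | ds where "cs @ ds = us" "ys = ds @ bs"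
      by (auto simp: append_eq_append_conv2)
    then show ?thesis
    proof cases
      case 1
      then show ?thesis using \<open>xs = as @ cs\<close> assms(1) * unfolding block_free_def by blast
    next
      case 2
      then show ?thesis using assms(3)[OF \<open>xs = as @ cs\<close> 2(2)] * assms(1,2) \<open>xs = as @ cs\<close>
        unfolding block_free_def
        by (metis append.left_neutral append.right_neutral)
    qed
  next
    case 2
    then show ?thesis using assms(2) * unfolding block_free_def by blast
  qed
qed

lemma block_free_append:
  assumes "block_free N xs" "block_free N ys"
    and "\<And>as us vs bs. xs = as @ us \<Longrightarrow> ys = vs @ bs \<Longrightarrow> us \<noteq> [] \<Longrightarrow> vs \<noteq> [] \<Longrightarrow> \<not> N (us @ vs)"
  shows "block_free N (xs @ ys)"
  unfolding block_free_iff
proof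
  show "proper_block_free N (xs @ ys)"
    by (rule proper_block_free_append) (use assms in auto)
  show "xs @ ys = [] \<or> \<not> N (xs @ ys)"
    using assms by (cases "xs = []"; cases "ys = []") (auto simp: block_free_iff)
qed

section \<open>Greedy ordering of two sets of opposite sign\<close>

lemma sum_list_pos: "xs \<noteq> [] \<Longrightarrow> (\<And>x. x \<in> set xs \<Longrightarrow> (0::int) < f x) \<Longrightarrow> 0 < sum_list (map f xs)"
proof (induction xs)
  case (Cons a xs)
  then show ?case by (cases "xs = []") (auto intro: add_pos_pos)
qed simp

lemma sum_list_map_uminus: "sum_list (map (\<lambda>x. - f x) xs) = - (sum_list (map f xs) :: int)"
  by (induction xs) auto

lemma sum_list_neg: "xs \<noteq> [] \<Longrightarrow> (\<And>x. x \<in> set xs \<Longrightarrow> f x < (0::int)) \<Longrightarrow> sum_list (map f xs) < 0"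
  using sum_list_pos[of xs "\<lambda>x. - f x"] by (simp add: sum_list_map_uminus)

lemma sum_list_map_zero: "(\<And>x. x \<in> set xs \<Longrightarrow> f x = 0) \<Longrightarrow> sum_list (map f xs) = (0 :: int)"
  by (induction xs) auto

lemma block_free_pos:
  "(\<And>x. x \<in> set xs \<Longrightarrow> 0 < z x) \<Longrightarrow> block_free (zero_block z h t 0) xs"
  unfolding block_free_def zero_block_def
  by (metis UnCI less_irrefl set_append sum_list_pos)

lemma block_free_neg:
  "(\<And>x. x \<in> set xs \<Longrightarrow> z x < 0) \<Longrightarrow> block_free (zero_block z h t 0) xs"
  unfolding block_free_def zero_block_def
  by (metis UnCI less_irrefl set_append sum_list_neg)

text \<open>\<open>ps\<close> and \<open>qs\<close> are both listed from the middle outwards: the eventual ordering is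
  \<open>rev qs\<close>, then a block with offset \<open>w\<close>, then \<open>ps\<close>.\<close>

definition separable :: "('a \<Rightarrow> int) \<Rightarrow> ('a \<Rightarrow> int) \<Rightarrow> int \<Rightarrow> int \<Rightarrow> 'a set \<Rightarrow> 'a set \<Rightarrow> bool" where
  "separable z h t w P Q \<longleftrightarrow> (\<exists>ps qs. distinct ps \<and> set ps = P \<and> distinct qs \<and> set qs = Q \<and>
     (\<forall>us us' vs vs'. ps = us @ us' \<longrightarrow> qs = vs @ vs' \<longrightarrow> us \<noteq> [] \<longrightarrow> vs \<noteq> [] \<longrightarrow> us' \<noteq> [] \<or> vs' \<noteq> []
        \<longrightarrow> \<not> zero_block z h t w (us @ vs)))"

text \<open>Reflecting \<open>z\<close> swaps the two sides; this allows the heavier side to be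
  treated as the positive one.\<close>

lemma separable_sym: "separable (\<lambda>x. - z x) h t w Q P \<Longrightarrow> separable z h t w P Q"
proof -
  assume "separable (\<lambda>x. - z x) h t w Q P"
  then obtain ps qs where o: "distinct ps" "set ps = Q" "distinct qs" "set qs = P"
    and sep: "\<And>us us' vs vs'. ps = us @ us' \<Longrightarrow> qs = vs @ vs' \<Longrightarrow> us \<noteq> [] \<Longrightarrow> vs \<noteq> [] \<Longrightarrow>
        us' \<noteq> [] \<or> vs' \<noteq> [] \<Longrightarrow> \<not> zero_block (\<lambda>x. - z x) h t w (us @ vs)"
    unfolding separable_def by blast
  have "zero_block (\<lambda>x. - z x) h t w (us @ vs) \<longleftrightarrow> zero_block z h t w (vs @ us)" for us vs
    unfolding zero_block_def by (simp add: sum_list_map_uminus algebra_simps) linarith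
  with sep have "\<not> zero_block z h t w (vs @ us)"
    if "ps = us @ us'" "qs = vs @ vs'" "us \<noteq> []" "vs \<noteq> []" "us' \<noteq> [] \<or> vs' \<noteq> []" for us us' vs vs'
    using that by blast
  with o show ?thesis unfolding separable_def
    by (intro exI[of _ qs] exI[of _ ps]) auto
qed

text \<open>One greedy step when the positive side is at least as heavy: some \<open>p\<close>
  becomes the outermost element of \<open>P\<close>. Pairs of prefixes that contain \<open>p\<close>
  leave out part of \<open>Q\<close> and so have positive \<open>z\<close>-sum. The others are
  covered by the ordering of the rest, except the pair consisting of everything but
  \<open>p\<close>, which the choice of \<open>p\<close> handles.\<close>

lemma separable_step:
  assumes fin: "finite P" "finite Q" and "P \<noteq> {}"
    and pos: "\<And>p. p \<in> P \<Longrightarrow> 0 < z p" and neg: "\<And>q. q \<in> Q \<Longrightarrow> z q < 0"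
    and inj: "\<And>a b. a \<in> P \<Longrightarrow> b \<in> P \<Longrightarrow> a \<noteq> b \<Longrightarrow> z a = z b \<Longrightarrow> \<not> t dvd h a - h b"
    and tot: "0 \<le> sum z P + sum z Q"
    and IH: "\<And>p. p \<in> P \<Longrightarrow> separable z h t w (P - {p}) Q"
  shows "separable z h t w P Q"
proof -
  \<comment> \<open>\<open>N p\<close> says that everything except \<open>p\<close>, together with
    the offset, sums to zero. Two elements with this property would agree in \<open>z\<close> and
    modulo \<open>t\<close> in \<open>h\<close>, so one of any two is a good choice. If
    \<open>P\<close> has one element, the remaining prefix is empty and nothing is required.\<close>
  define N where "N p \<longleftrightarrow> sum z P + sum z Q - z p = 0 \<and> t dvd w + sum h P + sum h Q - h p" for p
  obtain p where p: "p \<in> P" "P - {p} = {} \<or> \<not> N p"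
  proof (cases "\<exists>p. P = {p}")
    case False
    then obtain a b where ab: "a \<in> P" "b \<in> P" "a \<noteq> b" using \<open>P \<noteq> {}\<close> by blast
    have "\<not> (N a \<and> N b)"
    proof
      assume *: "N a \<and> N b"
      then have "t dvd (w + sum h P + sum h Q - h b) - (w + sum h P + sum h Q - h a)"
        unfolding N_def by (meson dvd_diff)
      moreover have "z a = z b" using * unfolding N_def by auto
      ultimately show False using inj[OF ab] by (simp add: algebra_simps)
    qed
    then show ?thesis using that ab by blast
  next
    case True
    then show ?thesis using that by (metis Diff_cancel insertI1)
  qed
  obtain ps qs where o: "distinct ps" "set ps = P - {p}" "distinct qs" "set qs = Q"
    and sep: "\<And>us us' vs vs'. ps = us @ us' \<Longrightarrow> qs = vs @ vs' \<Longrightarrow> us \<noteq> [] \<Longrightarrow> vs \<noteq> [] \<Longrightarrow>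
        us' \<noteq> [] \<or> vs' \<noteq> [] \<Longrightarrow> \<not> zero_block z h t w (us @ vs)"
    using IH[OF p(1)] unfolding separable_def by blast
  have sums: "sum_list (map f ps) = sum f P - f p" "sum_list (map f qs) = sum f Q" for f :: "'a \<Rightarrow> int"
    using o fin p(1) by (simp_all add: sum_list_distinct_conv_sum_set sum_diff1)
  have main: "\<not> zero_block z h t w (us @ vs)"
    if *: "ps @ [p] = us @ us'" "qs = vs @ vs'" "us \<noteq> []" "vs \<noteq> []" "us' \<noteq> [] \<or> vs' \<noteq> []" for us us' vs vs'
  proof (cases us' rule: rev_cases)
    \<comment> \<open>The total is nonnegative and the omitted rest \<open>vs'\<close> of
      \<open>Q\<close> is negative, so what remains is positive.\<close>
    case Nil
    then have "sum_list (map z vs') < 0"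
      using * o neg by (intro sum_list_neg) auto
    moreover have "sum_list (map z vs) + sum_list (map z vs') = sum z Q"
      using sums(2)[of z] *(2) by simp
    moreover have "sum_list (map z us) = sum z P" using Nil * sums(1)[of z] by auto
    ultimately show ?thesis using tot by (simp add: zero_block_def)
  next
    case (snoc us'' x)
    then have 1: "ps = us @ us''" using * by auto
    show ?thesis
    proof (cases "us'' = [] \<and> vs' = []")
      case True
      then have "us = ps" "vs = qs" using 1 * by auto
      moreover have "\<not> N p" using p(2) o(2) \<open>us = ps\<close> \<open>us \<noteq> []\<close> by (metis set_empty)
      ultimately show ?thesis unfolding zero_block_def N_def
        by (simp add: sums algebra_simps)
    qed (use sep[OF 1 *(2-4)] in blast)
  qed
  have "distinct (ps @ [p])" "set (ps @ [p]) = P" using o p(1) by auto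
  with o(3,4) main show ?thesis unfolding separable_def by blast
qed

text \<open>Induction on the number of elements, peeling the outermost element off the side whose
  \<open>z\<close>-sum is larger in absolute value (\<open>P\<close> on a tie). If one side is
  empty, there is no pair of nonempty prefixes to avoid.\<close>

lemma separable:
  assumes "finite P" "finite Q"
    and "\<And>p. p \<in> P \<Longrightarrow> 0 < z p" "\<And>q. q \<in> Q \<Longrightarrow> z q < 0"
    and "\<And>a b. a \<in> P \<union> Q \<Longrightarrow> b \<in> P \<union> Q \<Longrightarrow> a \<noteq> b \<Longrightarrow> z a = z b \<Longrightarrow> \<not> t dvd h a - h b"
  shows "separable z h t w P Q"
  using assms
proof (induction "card P + card Q" arbitrary: P Q rule: less_induct)
  case less
  note prems = less.prems
  show ?case
  proof (cases "P = {} \<or> Q = {}")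
    case True
    obtain ps where ps: "distinct ps" "set ps = P" using finite_distinct_list[OF prems(1)] by blast
    obtain qs where qs: "distinct qs" "set qs = Q" using finite_distinct_list[OF prems(2)] by blast
    have "ps = [] \<or> qs = []" using True ps(2) qs(2) by (metis set_empty)
    with ps qs show ?thesis
      unfolding separable_def by (metis append_is_Nil_conv)
  next
    case False
    show ?thesis
    proof (cases "0 \<le> sum z P + sum z Q")
      case True
      show ?thesis
      proof (rule separable_step[OF prems(1,2) _ prems(3,4) _ True])
        show "P \<noteq> {}" using False by blast
        show "\<not> t dvd h a - h b" if "a \<in> P" "b \<in> P" "a \<noteq> b" "z a = z b" for a b
          using prems(5)[of a b] that by simp
        show "separable z h t w (P - {p}) Q" if "p \<in> P" for p
        proof (rule less.hyps)
          show "card (P - {p}) + card Q < card P + card Q"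
            using card_Diff1_less[OF prems(1) that] by simp
          show "\<not> t dvd h a - h b" if "a \<in> P - {p} \<union> Q" "b \<in> P - {p} \<union> Q" "a \<noteq> b" "z a = z b" for a b
            using prems(5)[of a b] that by blast
        qed (simp_all add: prems(1-4))
      qed
    next
      case neg: False
      show ?thesis
      proof (rule separable_sym, rule separable_step[OF prems(2,1)])
        show "Q \<noteq> {}" using False by blast
        show "0 < - z q" if "q \<in> Q" for q using prems(4)[OF that] by simp
        show "- z p < 0" if "p \<in> P" for p using prems(3)[OF that] by simp
        show "0 \<le> (\<Sum>x\<in>Q. - z x) + (\<Sum>x\<in>P. - z x)" using neg by (simp add: sum_negf)
        show "\<not> t dvd h a - h b" if "a \<in> Q" "b \<in> Q" "a \<noteq> b" "- z a = - z b" for a b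
          using prems(5)[of a b] that by simp
        show "separable (\<lambda>x. - z x) h t w (Q - {q}) P" if "q \<in> Q" for q
        proof -
          have "separable z h t w P (Q - {q})"
          proof (rule less.hyps)
            show "card P + card (Q - {q}) < card P + card Q"
              using card_Diff1_less[OF prems(2) that] by simp
            show "\<not> t dvd h a - h b" if "a \<in> P \<union> (Q - {q})" "b \<in> P \<union> (Q - {q})" "a \<noteq> b" "z a = z b" for a b
              using prems(5)[of a b] that by blast
          qed (simp_all add: prems(1-4))
          then show ?thesis by (simp add: separable_sym[of "\<lambda>x. - z x"])
        qed
      qed
    qed
  qed
qed

section \<open>Inserting the elements with \<open>z = 0\<close>\<close>

text \<open>A block that meets exactly one outer part has nonzero \<open>z\<close>-sum. A block that
  meets both contains all of \<open>os\<close>, so it comes from a pair of prefixes as in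
  \<open>separable\<close>; hence the offset \<open>sum h E\<close>.\<close>

lemma ordering_split:
  assumes "finite P" "finite Q" "finite E"
    and pos: "\<And>p. p \<in> P \<Longrightarrow> 0 < z p" and neg: "\<And>q. q \<in> Q \<Longrightarrow> z q < 0"
    and zero: "\<And>a. a \<in> E \<Longrightarrow> z a = 0"
    and inj: "\<And>a b. a \<in> P \<union> Q \<Longrightarrow> b \<in> P \<union> Q \<Longrightarrow> a \<noteq> b \<Longrightarrow> z a = z b \<Longrightarrow> \<not> t dvd h a - h b"
    and os: "distinct os" "set os = E" "block_free (zero_block z h t 0) os"
  obtains ps qs where "distinct ps" "set ps = P" "distinct qs" "set qs = Q"
    "block_free (zero_block z h t 0) (os @ ps)"
    "proper_block_free (zero_block z h t 0) (rev qs @ os @ ps)"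
proof -
  let ?N = "zero_block z h t 0"
  have os0: "sum_list (map z vs) = 0" if "set vs \<subseteq> E" for vs
    using that zero by (intro sum_list_map_zero) auto
  have "separable z h t (sum h E) P Q"
    by (rule separable) (use assms in blast)+
  then obtain ps qs where o: "distinct ps" "set ps = P" "distinct qs" "set qs = Q"
    and sep: "\<And>us us' vs vs'. ps = us @ us' \<Longrightarrow> qs = vs @ vs' \<Longrightarrow> us \<noteq> [] \<Longrightarrow> vs \<noteq> [] \<Longrightarrow>
        us' \<noteq> [] \<or> vs' \<noteq> [] \<Longrightarrow> \<not> zero_block z h t (sum h E) (us @ vs)"
    unfolding separable_def by blast
  have 1: "block_free ?N (os @ ps)"
  proof (rule block_free_append)
    fix as us vs bs assume "os = as @ us" "ps = vs @ bs" "us \<noteq> []" "vs \<noteq> []"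
    then show "\<not> ?N (us @ vs)"
      using os0[of us] sum_list_pos[of vs z] os o pos by (auto simp: zero_block_def)
  qed (use os o pos in \<open>auto intro: block_free_pos\<close>)
  moreover have "proper_block_free ?N (rev qs @ os @ ps)"
  proof (rule proper_block_free_append)
    fix as us vs bs
    assume *: "rev qs = as @ us" "os @ ps = vs @ bs" "us \<noteq> []" "vs \<noteq> []" "as \<noteq> [] \<or> bs \<noteq> []"
    have qs: "qs = rev us @ rev as" using *(1) by (metis rev_append rev_rev_ident)
    have "sum_list (map z us) < 0" using * o neg by (intro sum_list_neg) (auto simp: qs)
    from *(2) consider bs' where "os = vs @ bs'" | vs' where "vs = os @ vs'" "ps = vs' @ bs"
      by (auto simp: append_eq_append_conv2)
    then show "\<not> ?N (us @ vs)"
    proof cases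
      case 1
      then show ?thesis using os0[of vs] os \<open>sum_list (map z us) < 0\<close> by (auto simp: zero_block_def)
    next
      case 2
      show ?thesis
      proof (cases "vs' = []")
        case True
        then show ?thesis using 2 os0[of vs] os \<open>sum_list (map z us) < 0\<close> by (auto simp: zero_block_def)
      next
        case False
        have "sum_list (map h os) = sum h E" using os by (simp add: sum_list_distinct_conv_sum_set)
        then show ?thesis using sep[OF 2(2) qs] False * os0[of os] os 2
          by (auto simp: zero_block_def rev_map[symmetric] add_ac)
      qed
    qed
  qed (use 1 o neg in \<open>auto intro: block_free_neg\<close>)
  ultimately show ?thesis using that o by blast
qed

text \<open>A middle part with sum zero would be a forbidden block, so one element \<open>e\<close>
  is moved to the far positive end. It is chosen such that the list without it does not sum to zero.
  That list is then block free, and any longer block ending in \<open>e\<close>, short of the whole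
  list, has positive \<open>z\<close>-sum because the negative elements come first and the total is
  nonnegative.\<close>

lemma ordering_split_zero_sum:
  assumes "finite P" "finite Q" "finite E"
    and pos: "\<And>p. p \<in> P \<Longrightarrow> 0 < z p" and neg: "\<And>q. q \<in> Q \<Longrightarrow> z q < 0"
    and zero: "\<And>a. a \<in> E \<Longrightarrow> z a = 0"
    and inj: "\<And>a b. a \<in> P \<union> Q \<union> E \<Longrightarrow> b \<in> P \<union> Q \<union> E \<Longrightarrow> a \<noteq> b \<Longrightarrow> z a = z b \<Longrightarrow> \<not> t dvd h a - h b"
    and nz: "\<And>a. a \<in> E \<Longrightarrow> \<not> t dvd h a"
    and "E \<noteq> {}" "t dvd sum h E"
    and weak: "\<And>A. A \<subseteq> E \<Longrightarrow> \<exists>os. distinct os \<and> set os = A \<and> proper_block_free (zero_block z h t 0) os"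
    and tot: "0 \<le> sum z P + sum z Q" and "P \<union> Q \<noteq> {}"
  shows "\<exists>xs. distinct xs \<and> set xs = P \<union> Q \<union> E \<and> proper_block_free (zero_block z h t 0) xs"
proof -
  let ?N = "zero_block z h t 0"
  have "P \<noteq> {}"
  proof
    assume "P = {}"
    then have "0 < sum (\<lambda>q. - z q) Q" using neg assms(2) \<open>P \<union> Q \<noteq> {}\<close> by (intro sum_pos) auto
    then show False using tot \<open>P = {}\<close> by (simp add: sum_negf)
  qed
  obtain x where x: "x \<in> E" using \<open>E \<noteq> {}\<close> by blast
  \<comment> \<open>A single nonzero residue cannot have sum zero, so there is a second
    element.\<close>
  have "E \<noteq> {x}" using nz[OF x] \<open>t dvd sum h E\<close> by auto
  then obtain y where y: "y \<in> E" "x \<noteq> y" using x by blast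
  define W where "W = sum h P + sum h Q + sum h E"
  \<comment> \<open>\<open>x\<close> and \<open>y\<close> both have \<open>z = 0\<close> and hence
    differ modulo \<open>t\<close>; at most one of them can make the remaining total
    \<open>W - h e\<close> vanish.\<close>
  obtain e where e: "e \<in> E" "\<not> t dvd W - h e"
  proof (cases "t dvd W - h x")
    case True
    have "\<not> t dvd h x - h y" using inj[of x y] x y zero by simp
    then have "\<not> t dvd W - h y"
      using dvd_diff[of t "W - h y" "W - h x"] True by auto
    then show ?thesis using that y by blast
  qed (use that x in blast)
  have sum_e: "sum h (E - {e}) = sum h E - h e" using assms(3) e by (simp add: sum_diff1)
  obtain os where os: "distinct os" "set os = E - {e}" "proper_block_free ?N os"
    using weak[of "E - {e}"] by blast
  have "sum_list (map h os) = sum h E - h e" using os sum_e by (simp add: sum_list_distinct_conv_sum_set)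
  \<comment> \<open>Removing \<open>e\<close> from a zero sum leaves \<open>- h e\<close>, which is
    nonzero modulo \<open>t\<close>.\<close>
  then have "\<not> ?N os" using \<open>t dvd sum h E\<close> nz[OF e(1)]
    by (auto simp: zero_block_def dvd_diff_right_iff)
  then have bf_os: "block_free ?N os" using os by (simp add: block_free_iff)
  obtain ps qs where o: "distinct ps" "set ps = P" "distinct qs" "set qs = Q"
    and bf: "block_free ?N (os @ ps)" and pbf: "proper_block_free ?N (rev qs @ os @ ps)"
  proof (rule ordering_split[of P Q "E - {e}" z t h os])
    show "\<not> t dvd h a - h b" if "a \<in> P \<union> Q" "b \<in> P \<union> Q" "a \<noteq> b" "z a = z b" for a b
      using inj[of a b] that by blast
  qed (use assms(1-3) pos neg zero os bf_os in auto)
  have sums: "sum_list (map f ps) = sum f P" "sum_list (map f qs) = sum f Q" 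
     "sum_list (map f os) = sum f E - f e" for f :: "'a \<Rightarrow> int"
    using o os e assms(3) by (simp_all add: sum_list_distinct_conv_sum_set sum_diff1)
  have z0: "sum z E = 0" "z e = 0" using zero e by auto
  have "\<not> ?N (rev qs @ os @ ps)"
    using e(2) by (simp add: zero_block_def rev_map[symmetric] sums W_def algebra_simps)
  then have bf: "block_free ?N ((rev qs @ os) @ ps)" using pbf by (simp add: block_free_iff)
  have "proper_block_free ?N (((rev qs @ os) @ ps) @ [e])"
  proof (rule proper_block_free_append[OF bf])
    show "block_free ?N [e]" using nz[OF e(1)]
      by (auto simp: block_free_def zero_block_def append_eq_Cons_conv Cons_eq_append_conv)
    fix as us vs bs
    assume *: "(rev qs @ os) @ ps = as @ us" "[e] = vs @ bs" "us \<noteq> []" "vs \<noteq> []" "as \<noteq> [] \<or> bs \<noteq> []"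
    then have vs: "vs = [e]" "bs = []" "as \<noteq> []" by (auto simp: Cons_eq_append_conv)
    have "0 < sum_list (map z us)"
    proof -
      \<comment> \<open>The suffix \<open>us\<close> starts in \<open>ps\<close>, in
        \<open>os\<close> or in \<open>rev qs\<close>. In the first two cases only positive elements
        contribute to the \<open>z\<close>-sum; in the third the omitted initial part
        \<open>as\<close> is negative while the total is not.\<close>
      consider cs where "ps = cs @ us" | us' where "us = us' @ ps" "rev qs @ os = as @ us'"
        using *(1) append_eq_append_conv2[of "rev qs @ os" ps as us] by auto
      then show ?thesis
      proof cases
        case 1
        then show ?thesis using * o pos by (intro sum_list_pos) auto
      next
        case 2
        then consider cs where "os = cs @ us'" | us'' where "us' = us'' @ os" "rev qs = as @ us''"
          using append_eq_append_conv2[of "rev qs" os as us'] by auto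
        then show ?thesis
        proof cases
          case 1
          then have "sum_list (map z us') = 0" using os zero by (intro sum_list_map_zero) auto
          moreover have "0 < sum_list (map z ps)" using o \<open>P \<noteq> {}\<close> pos by (intro sum_list_pos) auto
          ultimately show ?thesis using 2 by simp
        next
          case 3: 2
          have "qs = rev us'' @ rev as" using 3(2) by (metis rev_append rev_rev_ident)
          then have "sum_list (map z as) + sum_list (map z us'') = sum z Q"
            using sums(2)[of z] by (simp add: rev_map[symmetric])
          moreover have "sum_list (map z as) < 0" 
            using vs o neg \<open>qs = _\<close> by (intro sum_list_neg) auto
          ultimately show ?thesis using 2 3 tot z0 by (simp add: sums)
        qed
      qed
    qed
    then show "\<not> ?N (us @ vs)" using vs z0 by (simp add: zero_block_def)
  qed
  moreover have "P \<inter> Q = {}" "P \<inter> E = {}" "Q \<inter> E = {}"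
    using pos neg zero by (metis disjoint_iff less_asym less_irrefl)+
  ultimately show ?thesis using o os e
    by (intro exI[of _ "((rev qs @ os) @ ps) @ [e]"]) auto
qed

text \<open>\<open>S\<close> splits by the sign of \<open>z\<close>. A middle part whose sum is not
  zero modulo \<open>t\<close> can stay together; otherwise one of its elements may have to move
  out, which is why \<open>weak\<close> speaks of all subsets at level \<open>z = 0\<close>.\<close>

lemma ordering_extension:
  assumes "finite S"
    and inj: "\<And>a b. a \<in> S \<Longrightarrow> b \<in> S \<Longrightarrow> a \<noteq> b \<Longrightarrow> z a = z b \<Longrightarrow> \<not> t dvd h a - h b"
    and nz: "\<And>a. a \<in> S \<Longrightarrow> z a = 0 \<Longrightarrow> \<not> t dvd h a"
    and weak: "\<And>A. A \<subseteq> S \<Longrightarrow> (\<And>a. a \<in> A \<Longrightarrow> z a = 0) \<Longrightarrow>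
      \<exists>os. distinct os \<and> set os = A \<and> proper_block_free (zero_block z h t 0) os"
  shows "\<exists>xs. distinct xs \<and> set xs = S \<and> proper_block_free (zero_block z h t 0) xs"
proof -
  let ?N = "zero_block z h t 0"
  define P Q E where "P = {x \<in> S. 0 < z x}" and "Q = {x \<in> S. z x < 0}" and "E = {x \<in> S. z x = 0}"
  have S: "S = P \<union> Q \<union> E" unfolding P_def Q_def E_def by auto
  have fin: "finite P" "finite Q" "finite E" using assms(1) S by auto
  have pos: "\<And>p. p \<in> P \<Longrightarrow> 0 < z p" and neg: "\<And>q. q \<in> Q \<Longrightarrow> z q < 0" and zero: "\<And>a. a \<in> E \<Longrightarrow> z a = 0"
    unfolding P_def Q_def E_def by auto
  have weakO: "\<exists>os. distinct os \<and> set os = A \<and> proper_block_free ?N os" if "A \<subseteq> E" for A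
    using weak[of A] that S zero by blast
  obtain os where os: "distinct os" "set os = E" "proper_block_free ?N os" using weakO by blast
  have sums: "sum_list (map f os) = sum f E" for f :: "'a \<Rightarrow> int"
    using os by (simp add: sum_list_distinct_conv_sum_set)
  consider "P \<union> Q = {}" | "E = {} \<or> \<not> t dvd sum h E"
    | "P \<union> Q \<noteq> {}" "E \<noteq> {}" "t dvd sum h E" "0 \<le> sum z P + sum z Q"
    | "P \<union> Q \<noteq> {}" "E \<noteq> {}" "t dvd sum h E" "sum z P + sum z Q < 0" by linarith
  then show ?thesis
  proof cases
    case 1
    then show ?thesis using os S by auto
  next
    case 2
    then have bf_os: "block_free ?N os" using os by (auto simp: block_free_iff zero_block_def sums)
    obtain ps qs where "distinct ps" "set ps = P" "distinct qs" "set qs = Q"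
      "proper_block_free ?N (rev qs @ os @ ps)"
    proof (rule ordering_split[of P Q E z t h os])
      show "\<not> t dvd h a - h b" if "a \<in> P \<union> Q" "b \<in> P \<union> Q" "a \<noteq> b" "z a = z b" for a b
        using inj[of a b] that S by blast
    qed (use fin pos neg zero os bf_os that in auto)
    moreover have "P \<inter> Q = {}" "P \<inter> E = {}" "Q \<inter> E = {}"
      using pos neg zero by (metis disjoint_iff less_asym less_irrefl)+
    ultimately show ?thesis using os S
      by (intro exI[of _ "rev qs @ os @ ps"]) auto
  next
    case 3
    show ?thesis unfolding S
    proof (rule ordering_split_zero_sum[OF fin])
      show "\<not> t dvd h a - h b" if "a \<in> P \<union> Q \<union> E" "b \<in> P \<union> Q \<union> E" "a \<noteq> b" "z a = z b" for a b
        using inj[of a b] that S by blast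
      show "\<not> t dvd h a" if "a \<in> E" for a using nz[of a] zero[of a] that S by blast
    qed (fact pos neg zero weakO 3)+
  next
    case 4
    \<comment> \<open>A zero block does not see the sign of \<open>z\<close>, so this case is the
      mirror image of the previous one.\<close>
    have "zero_block (\<lambda>x. - z x) h t 0 = ?N"
      by (rule ext) (simp add: zero_block_def sum_list_map_uminus)
    then have "\<exists>xs. distinct xs \<and> set xs = Q \<union> P \<union> E \<and> proper_block_free (zero_block (\<lambda>x. - z x) h t 0) xs"
    proof (intro ordering_split_zero_sum[OF fin(2,1,3)])
      show "\<not> t dvd h a - h b" if "a \<in> Q \<union> P \<union> E" "b \<in> Q \<union> P \<union> E" "a \<noteq> b" "- z a = - z b" for a b
        using inj[of a b] that S by auto
      show "\<not> t dvd h a" if "a \<in> E" for a using nz[of a] zero[of a] that S by blast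
      show "\<exists>os. distinct os \<and> set os = A \<and> proper_block_free (zero_block (\<lambda>x. - z x) h t 0) os"
        if "A \<subseteq> E" for A
        using weakO[OF that] \<open>zero_block (\<lambda>x. - z x) h t 0 = ?N\<close> by simp
      show "0 \<le> (\<Sum>x\<in>Q. - z x) + (\<Sum>x\<in>P. - z x)" using 4 by (simp add: sum_negf)
      show "Q \<union> P \<noteq> {}" using 4 by blast
    qed (use 4 pos neg zero in simp_all)
    then show ?thesis unfolding S \<open>zero_block (\<lambda>x. - z x) h t 0 = ?N\<close> by (simp add: Un_commute)
  qed
qed

section \<open>Lifting subset-sum relations to the integers\<close>

text \<open>Laplace expansion along the first column multiplies the bound by the number of rows. The
  factor 1/2 enters at two rows, where the determinant is still at most 1 in absolute value; sizes 0
  and 1 need the first alternative.\<close>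

lemma zero_one_det_bound:
  fixes A :: "int mat"
  assumes "A \<in> carrier_mat r r" "\<And>i j. i < r \<Longrightarrow> j < r \<Longrightarrow> A $$ (i, j) \<in> {0, 1}"
  shows "\<bar>det A\<bar> \<le> 1 \<or> 2 \<le> r \<and> 2 * \<bar>det A\<bar> \<le> fact r"
  using assms
proof (induction r arbitrary: A)
  case 0
  then show ?case by simp
next
  case (Suc r)
  have md: "mat_delete A i 0 \<in> carrier_mat r r"
    "\<And>a b. a < r \<Longrightarrow> b < r \<Longrightarrow> mat_delete A i 0 $$ (a, b) \<in> {0, 1}" if "i < Suc r" for i
    using Suc.prems that by (auto simp: mat_delete_def)
  have exp: "det A = (\<Sum>i<Suc r. A $$ (i, 0) * ((-1) ^ i * det (mat_delete A i 0)))"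
    using laplace_expansion_column[OF Suc.prems(1), of 0] by (simp add: cofactor_def)
  consider "r = 0" | "r = 1" | "2 \<le> r" by linarith
  then show ?case
  proof cases
    case 1
    then show ?thesis using Suc.prems(1) Suc.prems(2)[of 0 0] by (auto simp: det_single)
  next
    case 2
    have "det (mat_delete A i 0) \<in> {0, 1}" if "i < 2" for i
      using md[of i] that 2 by (auto simp: det_single)
    then have "det (mat_delete A 0 0) \<in> {0, 1}" "det (mat_delete A 1 0) \<in> {0, 1}" by auto
    moreover have "A $$ (0, 0) \<in> {0, 1}" "A $$ (1, 0) \<in> {0, 1}" using Suc.prems 2 by auto
    ultimately show ?thesis using exp 2 by (auto simp: numeral_2_eq_2)
  next
    case 3
    have "2 * \<bar>det (mat_delete A i 0)\<bar> \<le> fact r" if "i < Suc r" for i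
    proof -
      have "(2::int) \<le> fact r" using fact_mono[OF 3, where 'a=int] by simp
      then show ?thesis using Suc.IH[OF md(1) md(2)] that by fastforce
    qed
    moreover have "\<bar>A $$ (i, 0)\<bar> \<le> 1" if "i < Suc r" for i
      using Suc.prems(2)[OF that, of 0] by auto
    ultimately have *: "2 * \<bar>A $$ (i, 0) * ((-1) ^ i * det (mat_delete A i 0))\<bar> \<le> fact r" if "i < Suc r" for i
      using that mult_mono[of "\<bar>A $$ (i, 0)\<bar>" 1 "2 * \<bar>det (mat_delete A i 0)\<bar>" "fact r"]
      by (simp add: abs_mult power_abs)
    have "2 * \<bar>det A\<bar> \<le> (\<Sum>i<Suc r. 2 * \<bar>A $$ (i, 0) * ((-1) ^ i * det (mat_delete A i 0))\<bar>)"
      unfolding exp sum_distrib_left[symmetric] by (intro mult_left_mono sum_abs) simp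
    also have "\<dots> \<le> (\<Sum>i<Suc r. fact r)" by (intro sum_mono *) simp
    also have "\<dots> = fact (Suc r)" by (simp add: algebra_simps)
    finally show ?thesis using 3 by simp
  qed
qed

section \<open>Integer solutions that detect finitely many linear forms\<close>

text \<open>The coefficients are chosen one at a time: for each \<open>v\<close> with
  \<open>v a\<close> nonzero, at most one value of the new coefficient makes the sum vanish, and
  finitely many \<open>v\<close> leave an integer free.\<close>

lemma separating_combination:
  fixes V :: "('a \<Rightarrow> int) set"
  assumes "finite L" "finite V"
  shows "\<exists>\<beta>. \<forall>v\<in>V. (\<Sum>l\<in>L. \<beta> l * v l) = 0 \<longrightarrow> (\<forall>l\<in>L. v l = 0)"
  using assms(1)
proof (induction L)
  case empty
  then show ?case by simp
next
  case (insert a L)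
  then obtain \<beta> where \<beta>: "\<And>v. v \<in> V \<Longrightarrow> (\<Sum>l\<in>L. \<beta> l * v l) = 0 \<Longrightarrow> (\<forall>l\<in>L. v l = 0)" by blast
  define B where "B = (\<lambda>v. - (\<Sum>l\<in>L. \<beta> l * v l) div v a) ` V"
  have "finite B" unfolding B_def using assms by simp
  then obtain b where b: "b \<notin> B" using ex_new_if_finite infinite_UNIV_int by blast
  have "\<forall>l\<in>insert a L. v l = 0" if v: "v \<in> V" "(\<Sum>l\<in>insert a L. (\<beta>(a := b)) l * v l) = 0" for v
  proof -
    have "(\<Sum>l\<in>L. (\<beta>(a := b)) l * v l) = (\<Sum>l\<in>L. \<beta> l * v l)"
      using insert.hyps by (intro sum.cong) auto
    then have eq: "b * v a = - (\<Sum>l\<in>L. \<beta> l * v l)" using v(2) insert.hyps by simp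
    have "v a = 0"
    proof (rule ccontr)
      assume "v a \<noteq> 0"
      then have "b = - (\<Sum>l\<in>L. \<beta> l * v l) div v a" using eq by (metis nonzero_mult_div_cancel_right)
      then show False using b v(1) unfolding B_def by blast
    qed
    then show ?thesis using \<beta>[OF v(1)] eq by simp
  qed
  then show ?case by blast
qed

text \<open>Integer solutions of all the subset relations suffice to test a linear form modulo
  \<open>m\<close>: if \<open>u\<close> vanishes on them, then \<open>d * u\<close> is an integer
  combination of relations, where \<open>d\<close> is a maximal nonzero minor and therefore
  invertible modulo \<open>m\<close>. A single solution \<open>z\<close> is then picked that detects
  each of the finitely many forms in \<open>V\<close>.\<close>

lemma lift_combinatorial_relations:
  fixes x :: "'a \<Rightarrow> int"
  assumes "finite S" "card S = k" "k \<ge> 2"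
    and cop: "\<And>d::int. d \<noteq> 0 \<Longrightarrow> 2 * \<bar>d\<bar> \<le> fact k \<Longrightarrow> coprime d m"
    and "finite V"
  obtains z :: "'a \<Rightarrow> int" where
    "\<And>U. U \<subseteq> S \<Longrightarrow> m dvd sum x U \<Longrightarrow> sum z U = 0"
    "\<And>v. v \<in> V \<Longrightarrow> (\<Sum>s\<in>S. v s * z s) = 0 \<Longrightarrow> m dvd (\<Sum>s\<in>S. v s * x s)"
proof -
  define \<A> where "\<A> = {U. U \<subseteq> S \<and> m dvd sum x U}"
  define M :: "nat \<Rightarrow> (nat \<Rightarrow> 'a set) \<Rightarrow> (nat \<Rightarrow> 'a) \<Rightarrow> int mat"
    where "M r a c = mat r r (\<lambda>(i, j). of_bool (c j \<in> a i))" for r a c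
  \<comment> \<open>Rows are relations and columns are elements of \<open>S\<close>. A repeated row
    or column makes the determinant zero, so \<open>a\<close> and \<open>c\<close> can be arbitrary
    functions.\<close>
  define good where "good r \<longleftrightarrow> (\<exists>a c. a ` {..<r} \<subseteq> \<A> \<and> c ` {..<r} \<subseteq> S \<and> det (M r a c) \<noteq> 0)" for r
  have "good 0" unfolding good_def M_def by (simp add: det_dim_zero)
  have bound: "r \<le> k" if r: "good r" for r
  proof -
    obtain a c where *: "c ` {..<r} \<subseteq> S" "det (M r a c) \<noteq> 0" using r unfolding good_def by blast
    have "inj_on c {..<r}"
    proof (rule inj_onI, rule ccontr)
      fix i j assume ij: "i \<in> {..<r}" "j \<in> {..<r}" "c i = c j" "i \<noteq> j"
      have "det (M r a c) = 0"
        by (rule det_identical_columns[of _ r i j]) (use ij in \<open>auto simp: M_def intro!: eq_vecI\<close>)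
      then show False using * by simp
    qed
    then have "card (c ` {..<r}) = r" by (simp add: card_image)
    then show ?thesis using card_mono[OF assms(1) *(1)] assms(2) by simp
  qed
  define r where "r = (GREATEST r. good r)"
  have "good r" unfolding r_def by (rule GreatestI_nat[of good 0 k]) (use \<open>good 0\<close> bound in auto)
  have max: "\<not> good (Suc r)"
    using Greatest_le_nat[of good "Suc r" k] bound unfolding r_def by fastforce
  obtain a c where ac: "a ` {..<r} \<subseteq> \<A>" "c ` {..<r} \<subseteq> S" and d0: "det (M r a c) \<noteq> 0"
    using \<open>good r\<close> unfolding good_def by blast
  define d where "d = det (M r a c)"
  \<comment> \<open>For \<open>r\<close> below 2 the determinant has absolute value at most 1, and
    then \<open>k \<ge> 2\<close> gives the bound by \<open>fact k\<close>.\<close>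
  have "\<bar>d\<bar> \<le> 1 \<or> 2 \<le> r \<and> 2 * \<bar>d\<bar> \<le> fact r"
    unfolding d_def by (rule zero_one_det_bound) (auto simp: M_def)
  moreover have "(2::int) \<le> fact k" using fact_mono[OF assms(3), where 'a=int] by simp
  moreover have "(fact r :: int) \<le> fact k" using bound[OF \<open>good r\<close>] by (rule fact_mono)
  ultimately have "coprime d m" using cop[of d] d0 unfolding d_def by linarith
  \<comment> \<open>\<open>B u l\<close> borders the maximal nonsingular submatrix by the row \<open>u\<close> and the column \<open>l\<close>. Its
    determinant is linear in \<open>u\<close>, vanishes on all relations by maximality of \<open>r\<close>, and modulo the
    relations it is \<open>d * u l\<close>; so the coefficients of these linear forms are the desired lift.\<close>
  define B where "B u l = mat (Suc r) (Suc r) (\<lambda>(i, j). (if i < r then \<lambda>s. of_bool (s \<in> a i) else u) (if j < r then c j else l))"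
    for u :: "'a \<Rightarrow> int" and l
  have Bc: "B u l \<in> carrier_mat (Suc r) (Suc r)" for u l unfolding B_def by simp
  have corner: "cofactor (B u l) r r = d" for u l
    unfolding cofactor_def d_def by (auto simp: B_def M_def mat_delete_def intro!: arg_cong[of _ _ det] eq_matI)
  \<comment> \<open>Deleting the last row removes \<open>u\<close>, and deleting the last column
    removes \<open>l\<close>. So the zero row and \<open>undefined\<close> merely fill a vacant
    place.\<close>
  define \<kappa> where "\<kappa> l j = cofactor (B (\<lambda>_. 0) l) r j" for l j
  define \<mu> where "\<mu> u i = cofactor (B u undefined) i r" for u i
  have \<kappa>: "cofactor (B u l) r j = \<kappa> l j" if "j < Suc r" for u l j
    unfolding \<kappa>_def cofactor_def using that
    by (auto simp: B_def mat_delete_def intro!: arg_cong[of _ _ det] eq_matI)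
  have \<mu>: "cofactor (B u l) i r = \<mu> u i" if "i < Suc r" for u l i
    unfolding \<mu>_def cofactor_def using that
    by (auto simp: B_def mat_delete_def intro!: arg_cong[of _ _ det] eq_matI)
  have row: "det (B u l) = (\<Sum>j<r. u (c j) * \<kappa> l j) + u l * d" for u l
  proof -
    have "det (B u l) = (\<Sum>j<Suc r. B u l $$ (r, j) * cofactor (B u l) r j)"
      by (rule laplace_expansion_row[OF Bc]) simp
    also have "\<dots> = (\<Sum>j<r. B u l $$ (r, j) * cofactor (B u l) r j) + u l * d"
      by (simp add: corner) (simp add: B_def)
    also have "(\<Sum>j<r. B u l $$ (r, j) * cofactor (B u l) r j) = (\<Sum>j<r. u (c j) * \<kappa> l j)"
      by (intro sum.cong) (auto simp: \<kappa>, simp add: B_def)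
    finally show ?thesis .
  qed
  have column: "det (B u l) = (\<Sum>i<r. of_bool (l \<in> a i) * \<mu> u i) + u l * d" for u l
  proof -
    have "det (B u l) = (\<Sum>i<Suc r. B u l $$ (i, r) * cofactor (B u l) i r)"
      by (rule laplace_expansion_column[OF Bc]) simp
    also have "\<dots> = (\<Sum>i<r. B u l $$ (i, r) * cofactor (B u l) i r) + u l * d"
      by (simp add: corner) (simp add: B_def)
    also have "(\<Sum>i<r. B u l $$ (i, r) * cofactor (B u l) i r) = (\<Sum>i<r. of_bool (l \<in> a i) * \<mu> u i)"
      by (intro sum.cong) (auto simp: \<mu>, simp_all add: B_def)
    finally show ?thesis .
  qed
  \<comment> \<open>The coefficient of \<open>u s\<close> in the expansion of
    \<open>det (B u l)\<close> along its last row.\<close>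
  define Z where "Z l s = (\<Sum>j<r. of_bool (c j = s) * \<kappa> l j) + of_bool (l = s) * d" for l s
  have Z: "(\<Sum>s\<in>S. u s * Z l s) = det (B u l)" if "l \<in> S" for u l
  proof -
    have "(\<Sum>s\<in>S. u s * Z l s) =
        (\<Sum>s\<in>S. \<Sum>j<r. u s * of_bool (c j = s) * \<kappa> l j) + (\<Sum>s\<in>S. u s * of_bool (l = s) * d)"
      unfolding Z_def by (simp only: distrib_left sum.distrib sum_distrib_left mult.assoc)
    also have "(\<Sum>s\<in>S. \<Sum>j<r. u s * of_bool (c j = s) * \<kappa> l j) = (\<Sum>j<r. \<Sum>s\<in>S. u s * of_bool (c j = s) * \<kappa> l j)"
      by (rule sum.swap)
    also have "\<dots> = (\<Sum>j<r. u (c j) * \<kappa> l j)"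
    proof (intro sum.cong refl)
      fix j assume "j \<in> {..<r}"
      then have "c j \<in> S" using ac by auto
      have "(\<Sum>s\<in>S. u s * of_bool (c j = s) * \<kappa> l j) = (\<Sum>s\<in>S. if c j = s then u s * \<kappa> l j else 0)"
        by (intro sum.cong) auto
      then show "(\<Sum>s\<in>S. u s * of_bool (c j = s) * \<kappa> l j) = u (c j) * \<kappa> l j"
        using assms(1) \<open>c j \<in> S\<close> by simp
    qed
    also have "(\<Sum>s\<in>S. u s * of_bool (l = s) * d) = (\<Sum>s\<in>S. if l = s then u s * d else 0)"
      by (intro sum.cong) auto
    also have "\<dots> = u l * d" using assms(1) that by simp
    finally show ?thesis by (simp add: row)
  qed
  have relation: "det (B (\<lambda>s. of_bool (s \<in> U)) l) = 0" if "U \<in> \<A>" "l \<in> S" for U l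
  proof (rule ccontr)
    assume nz: "det (B (\<lambda>s. of_bool (s \<in> U)) l) \<noteq> 0"
    have "B (\<lambda>s. of_bool (s \<in> U)) l = M (Suc r) (a(r := U)) (c(r := l))"
      unfolding B_def M_def by (rule eq_matI) (auto simp: less_Suc_eq)
    then have "good (Suc r)" unfolding good_def using nz ac that
      by (intro exI[of _ "a(r := U)"] exI[of _ "c(r := l)"]) (auto simp: less_Suc_eq)
    then show False using max by simp
  qed
  \<comment> \<open>By expansion along the last column, vanishing determinants express
    \<open>d * u\<close> on \<open>S\<close> through the indicators of the sets \<open>a i\<close>,
    each of which pairs with \<open>x\<close> to a multiple of \<open>m\<close>.\<close>
  have dvd: "m dvd (\<Sum>s\<in>S. u s * x s)" if u: "\<And>l. l \<in> S \<Longrightarrow> det (B u l) = 0" for u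
  proof -
    have "m dvd (\<Sum>s\<in>S. of_bool (s \<in> a i) * x s)" if "i < r" for i
    proof -
      have "a i \<subseteq> S" "m dvd sum x (a i)" using ac(1) that unfolding \<A>_def by auto
      moreover have "(\<Sum>s\<in>S. of_bool (s \<in> a i) * x s) = sum x (a i)"
        using assms(1) \<open>a i \<subseteq> S\<close> by (intro sum.mono_neutral_cong_right) auto
      ultimately show ?thesis by simp
    qed
    then have "m dvd (\<Sum>i<r. \<mu> u i * (\<Sum>s\<in>S. of_bool (s \<in> a i) * x s))"
      by (intro dvd_sum) auto
    also have "(\<Sum>i<r. \<mu> u i * (\<Sum>s\<in>S. of_bool (s \<in> a i) * x s)) =
        (\<Sum>s\<in>S. (\<Sum>i<r. of_bool (s \<in> a i) * \<mu> u i) * x s)"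
      unfolding sum_distrib_left sum_distrib_right by (subst sum.swap) (simp add: mult_ac)
    also have "\<dots> = (\<Sum>s\<in>S. - (u s * d) * x s)"
    proof (intro sum.cong refl)
      fix s assume "s \<in> S"
      then have "(\<Sum>i<r. of_bool (s \<in> a i) * \<mu> u i) = - (u s * d)"
        using column[of u s] u by simp
      then show "(\<Sum>i<r. of_bool (s \<in> a i) * \<mu> u i) * x s = - (u s * d) * x s" by simp
    qed
    also have "\<dots> = - (d * (\<Sum>s\<in>S. u s * x s))"
      by (simp add: sum_distrib_left sum_negf mult_ac)
    finally have "m dvd d * (\<Sum>s\<in>S. u s * x s)" by simp
    then show ?thesis using \<open>coprime d m\<close> by (simp add: coprime_commute coprime_dvd_mult_right_iff)
  qed
  \<comment> \<open>The solutions \<open>Z l\<close> are combined so that a form in \<open>V\<close>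
    kills the combination only if it kills every one of them.\<close>
  obtain \<beta> where \<beta>: "\<And>v. v \<in> V \<Longrightarrow> (\<Sum>l\<in>S. \<beta> l * det (B v l)) = 0 \<Longrightarrow> (\<forall>l\<in>S. det (B v l) = 0)"
    using separating_combination[OF assms(1) finite_imageI[OF assms(5)], of "\<lambda>v l. det (B v l)"] by auto
  define z where "z s = (\<Sum>l\<in>S. \<beta> l * Z l s)" for s
  have z: "(\<Sum>s\<in>S. u s * z s) = (\<Sum>l\<in>S. \<beta> l * det (B u l))" for u
  proof -
    have "(\<Sum>s\<in>S. u s * z s) = (\<Sum>l\<in>S. \<beta> l * (\<Sum>s\<in>S. u s * Z l s))"
      unfolding z_def sum_distrib_left by (subst sum.swap) (simp add: mult_ac)
    then show ?thesis by (simp add: Z)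
  qed
  show ?thesis
  proof
    fix U assume U: "U \<subseteq> S" "m dvd sum x U"
    have "sum z U = (\<Sum>s\<in>S. of_bool (s \<in> U) * z s)"
      using assms(1) U by (intro sum.mono_neutral_cong_left) auto
    also have "\<dots> = 0" unfolding z using relation U by (simp add: \<A>_def)
    finally show "sum z U = 0" .
  next
    fix v assume "v \<in> V" "(\<Sum>s\<in>S. v s * z s) = 0"
    then show "m dvd (\<Sum>s\<in>S. v s * x s)" using \<beta> z dvd by simp
  qed
qed

section \<open>Small sets and small moduli\<close>

lemma proper_block_free_small:
  "proper_block_free N []"
  "proper_block_free N [a]"
  "\<not> N [a] \<Longrightarrow> \<not> N [b] \<Longrightarrow> proper_block_free N [a, b]"
  "\<not> N [a] \<Longrightarrow> \<not> N [b] \<Longrightarrow> \<not> N [c] \<Longrightarrow> \<not> N [a, b] \<Longrightarrow> \<not> N [b, c] \<Longrightarrow> proper_block_free N [a, b, c]"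
  "\<not> N [a] \<Longrightarrow> \<not> N [b] \<Longrightarrow> \<not> N [c] \<Longrightarrow> \<not> N [d] \<Longrightarrow> \<not> N [a, b] \<Longrightarrow> \<not> N [b, c] \<Longrightarrow> \<not> N [c, d] \<Longrightarrow>
    \<not> N [a, b, c] \<Longrightarrow> \<not> N [b, c, d] \<Longrightarrow> proper_block_free N [a, b, c, d]"
  by (auto simp: proper_block_free_def Cons_eq_append_conv)

text \<open>At most one of three pairs can sum to zero, since two pairs share an element and their
  other elements would be congruent. That pair is placed at the two ends, where it is not
  consecutive. The blocks are kept nonzero modulo \<open>t\<close>, so \<open>z\<close> may be
  arbitrary.\<close>

lemma ordering_card_le_3:
  fixes h :: "'a \<Rightarrow> int"
  assumes "finite A" "card A \<le> 3"
    and inj: "\<And>a b. a \<in> A \<Longrightarrow> b \<in> A \<Longrightarrow> a \<noteq> b \<Longrightarrow> \<not> t dvd h a - h b"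
    and nz: "\<And>a. a \<in> A \<Longrightarrow> \<not> t dvd h a"
  shows "\<exists>os. distinct os \<and> set os = A \<and> proper_block_free (zero_block z h t 0) os"
proof -
  consider "card A = 0" | "card A = 1" | "card A = 2" | "card A = 3" using assms(2) by linarith
  then show ?thesis
  proof cases
    case 1
    then show ?thesis using assms(1) by (intro exI[of _ "[]"]) (simp add: proper_block_free_small)
  next
    case 2
    then obtain a where "A = {a}" by (auto simp: card_1_singleton_iff)
    then show ?thesis
      by (intro exI[of _ "[a]"]) (simp add: proper_block_free_small)
  next
    case 3
    then obtain a b where "A = {a, b}" "a \<noteq> b" by (auto simp: card_2_iff)
    then have "proper_block_free (zero_block z h t 0) [a, b]"
      using nz[of a] nz[of b] by (intro proper_block_free_small) (simp_all add: zero_block_def)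
    moreover have "distinct [a, b]" "set [a, b] = A" using \<open>A = {a, b}\<close> \<open>a \<noteq> b\<close> by auto
    ultimately show ?thesis by blast
  next
    case 4
    then obtain a b c where A: "A = {a, b, c}" "a \<noteq> b" "b \<noteq> c" "a \<noteq> c" by (auto simp: card_3_iff)
    have order: ?thesis if "A = {p, q, r}" "distinct [p, q, r]" "\<not> t dvd h p + h q" "\<not> t dvd h q + h r" for p q r
    proof -
      have "proper_block_free (zero_block z h t 0) [p, q, r]"
        using that nz[of p] nz[of q] nz[of r]
        by (intro proper_block_free_small) (simp_all add: zero_block_def)
      moreover have "set [p, q, r] = A" using that by auto
      ultimately show ?thesis using that by blast
    qed
    have two: "\<not> (t dvd h p + h q \<and> t dvd h p + h r)" if "q \<in> A" "r \<in> A" "q \<noteq> r" for p q r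
      using inj[OF that] dvd_diff[of t "h p + h q" "h p + h r"] by auto
    consider "\<not> t dvd h a + h b" "\<not> t dvd h b + h c" | "t dvd h a + h b" | "t dvd h b + h c" by blast
    then show ?thesis
    proof cases
      case 1
      then show ?thesis using order[of a b c] A by auto
    next
      case 2
      then have "\<not> t dvd h a + h c" "\<not> t dvd h c + h b"
        using two[of b c a] two[of a c b] A by (auto simp: add.commute)
      then show ?thesis using order[of a c b] A by auto
    next
      case 3
      then have "\<not> t dvd h b + h a" "\<not> t dvd h a + h c"
        using two[of a c b] two[of b a c] A by (auto simp: add.commute)
      then show ?thesis using order[of b a c] A by auto
    qed
  qed
qed

text \<open>Distinct nonzero residues number at most \<open>t - 1\<close>, so four elements occur
  only for \<open>t = 5\<close>, where they represent all nonzero residues.\<close>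

lemma ordering_modulus_le_5:
  fixes h :: "'a \<Rightarrow> int"
  assumes "finite A" "0 < t" "t \<le> 5"
    and inj: "\<And>a b. a \<in> A \<Longrightarrow> b \<in> A \<Longrightarrow> a \<noteq> b \<Longrightarrow> \<not> t dvd h a - h b"
    and nz: "\<And>a. a \<in> A \<Longrightarrow> \<not> t dvd h a"
  shows "\<exists>os. distinct os \<and> set os = A \<and> proper_block_free (zero_block z h t 0) os"
proof -
  have "inj_on (\<lambda>a. h a mod t) A"
    by (intro inj_onI) (use inj in \<open>auto simp: mod_eq_dvd_iff\<close>)
  then have card: "card ((\<lambda>a. h a mod t) ` A) = card A" by (rule card_image)
  have sub: "(\<lambda>a. h a mod t) ` A \<subseteq> {1..<t}"
  proof (rule image_subsetI)
    fix a assume "a \<in> A"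
    then have "h a mod t \<noteq> 0" using nz by (simp add: dvd_eq_mod_eq_0)
    moreover have "0 \<le> h a mod t" "h a mod t < t" using assms(2) by simp_all
    ultimately show "h a mod t \<in> {1..<t}" by simp
  qed
  have "card A \<le> nat (t - 1)" using card_mono[OF _ sub] card by simp
  then consider "card A \<le> 3" | "card A = 4" "t = 5" using assms(3) by linarith
  then show ?thesis
  proof cases
    case 1
    then show ?thesis using ordering_card_le_3[of A t h] assms by blast
  next
    case 2
    then have img: "(\<lambda>a. h a mod 5) ` A = {1..<5}" using card_subset_eq[OF _ sub] card by simp
    have ex: "\<exists>a\<in>A. h a mod 5 = r" if "r \<in> {1..<5}" for r
      using that unfolding img[symmetric] by auto
    obtain a b c d where m: "h a mod 5 = 1" "h b mod 5 = 2" "h c mod 5 = 3" "h d mod 5 = 4"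
      and mem: "{a, b, c, d} \<subseteq> A"
      using ex[of 1] ex[of 2] ex[of 3] ex[of 4] by auto
    \<comment> \<open>The residues 1, 2, 4, 3 in this order have partial sums 0, 1, 3, 2, 0 modulo
      5, which are distinct except for the return to 0.\<close>
    have "distinct [a, b, d, c]" using m by auto
    moreover from this have "set [a, b, d, c] = A"
      using 2 mem assms(1) by (intro card_subset_eq) (auto simp: distinct_card)
    moreover have "\<not> 5 dvd h a" "\<not> 5 dvd h b" "\<not> 5 dvd h c" "\<not> 5 dvd h d"
        "\<not> 5 dvd h a + h b" "\<not> 5 dvd h b + h d" "\<not> 5 dvd h d + h c"
        "\<not> 5 dvd h a + (h b + h d)" "\<not> 5 dvd h b + (h d + h c)"
      using m by presburger+
    then have "proper_block_free (zero_block z h t 0) [a, b, d, c]"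
      unfolding \<open>t = 5\<close> by (intro proper_block_free_small) (simp_all add: zero_block_def)
    ultimately show ?thesis by blast
  qed
qed

section \<open>From orderings without zero blocks to sequenceable sets of residues\<close>

text \<open>Equal partial sums at \<open>i < j\<close> mean that the block between them has sum
  divisible by \<open>n\<close>. As only the full list may have such a sum, its total decides
  between the two kinds of sequencing.\<close>

lemma sequenceable_if_proper_block_free:
  assumes "distinct xs" "set xs = S" "proper_block_free (\<lambda>ys. n dvd sum_list ys) xs"
  shows "sequenceable n S"
proof -
  define f where "f i = sum_list (take i xs) mod n" for i
  have ps: "partial_sums n xs = map f [0..<Suc (length xs)]"
    unfolding partial_sums_def f_def ..
  have neq: "f i \<noteq> f j" if "i < j" "j \<le> length xs" "i \<noteq> 0 \<or> j \<noteq> length xs" for i j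
  proof
    assume eq: "f i = f j"
    have tj: "take j xs = take i xs @ drop i (take j xs)"
      using that by (metis append_take_drop_id min.absorb1 less_imp_le take_take)
    then have "sum_list (take j xs) = sum_list (take i xs) + sum_list (drop i (take j xs))"
      by (metis sum_list_append)
    then have "n dvd sum_list (drop i (take j xs))"
      using eq mod_eq_dvd_iff_nat[of "sum_list (take i xs)" "sum_list (take j xs)" n] unfolding f_def by simp
    moreover have "xs = take i xs @ drop i (take j xs) @ drop j xs"
      using tj by (metis append.assoc append_take_drop_id)
    moreover have "drop i (take j xs) \<noteq> []" "take i xs \<noteq> [] \<or> drop j xs \<noteq> []" using that by auto
    ultimately show False using assms(3) unfolding proper_block_free_def by blast
  qed
  show ?thesis
  proof (cases "f (length xs) = 0 \<and> xs \<noteq> []")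
    case True
    have "inj_on f {0..<length xs}"
      by (intro linorder_inj_onI) (use neq in auto)
    then have "is_rotational_sequencing n S xs"
      using assms True unfolding is_rotational_sequencing_def ps by (simp add: distinct_map)
    then show ?thesis unfolding sequenceable_def by blast
  next
    case False
    have "f i \<noteq> f j" if "i < j" "j \<le> length xs" for i j
      using neq[OF that] False that by (cases "i = 0 \<and> j = length xs") (auto simp: f_def)
    then have "inj_on f {0..<Suc (length xs)}"
      by (intro linorder_inj_onI) auto
    then have "is_sequencing n S xs"
      using assms unfolding is_sequencing_def ps by (simp add: distinct_map del: upt_Suc)
    then show ?thesis unfolding sequenceable_def by blast
  qed
qed

lemma residue_diff_not_dvd: "a < n \<Longrightarrow> b < n \<Longrightarrow> a \<noteq> b \<Longrightarrow> \<not> int n dvd int a - int b"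
  by (simp add: mod_eq_dvd_iff[symmetric])

text \<open>With \<open>z = 0\<close> and modulus \<open>n\<close>, a zero block is just a block
  whose sum is divisible by \<open>n\<close>. Sets this small are treated apart because
  \<open>k!/2\<close> is then too small to force \<open>m\<close> and \<open>t\<close> to be
  coprime.\<close>

lemma sequenceable_card_le_3:
  assumes S: "S \<subseteq> {1..<n}" and "card S \<le> 3"
  shows "sequenceable n S"
proof -
  have "\<not> int n dvd int a - int b" if "a \<in> S" "b \<in> S" "a \<noteq> b" for a b
    using S that by (intro residue_diff_not_dvd) auto
  moreover have "\<not> int n dvd int a" if "a \<in> S" for a
    using S that nat_dvd_not_less[of a n] by (auto simp: subset_iff Suc_le_eq)
  ultimately obtain xs where xs: "distinct xs" "set xs = S" "proper_block_free (zero_block (\<lambda>_. 0) int (int n) 0) xs"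
    using ordering_card_le_3[of S "int n" int] finite_subset[OF S] assms(2) by blast
  have "zero_block (\<lambda>_. 0) int (int n) 0 ys \<longleftrightarrow> n dvd sum_list ys" for ys
  proof -
    have "sum_list (map int ys) = int (sum_list ys)" by (induction ys) auto
    then show ?thesis by (simp add: zero_block_def sum_list_triv)
  qed
  then show ?thesis using sequenceable_if_proper_block_free[OF xs(1,2)] xs(3)
    by (simp add: proper_block_free_def)
qed

text \<open>The component in Z_m is replaced by the lift \<open>z\<close>, while the residue itself
  represents the component in Z_t. A block with sum zero modulo \<open>n\<close> is a subset sum
  that vanishes modulo \<open>m\<close>, hence also under \<open>z\<close>, so it would be a zero
  block.\<close>

lemma sequenceable_modulus_le_5:
  assumes "0 < t" "t \<le> 5" "n = m * t"
    and primes: "\<And>p. prime p \<Longrightarrow> p dvd m \<Longrightarrow> fact (card S) < 2 * p"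
    and S: "S \<subseteq> {1..<n}"
  shows "sequenceable n S"
proof (cases "card S \<le> 3")
  case True
  then show ?thesis using sequenceable_card_le_3 S by blast
next
  case False
  have fin: "finite S" using S finite_subset by blast
  have cop: "coprime d (int m)" if d: "d \<noteq> 0" "2 * \<bar>d\<bar> \<le> fact (card S)" for d
  proof -
    have "coprime (nat \<bar>d\<bar>) m"
    proof (rule ccontr)
      assume "\<not> coprime (nat \<bar>d\<bar>) m"
      then obtain p where p: "prime p" "p dvd gcd (nat \<bar>d\<bar>) m"
        using prime_factor_nat by (metis coprime_iff_gcd_eq_1)
      then have "p dvd nat \<bar>d\<bar>" "p dvd m" by (meson dvd_trans gcd_dvd1 gcd_dvd2)+
      have "p \<le> nat \<bar>d\<bar>" using \<open>p dvd nat \<bar>d\<bar>\<close> d(1) by (intro dvd_imp_le) auto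
      then have "int (2 * p) \<le> fact (card S)" using d(2) by linarith
      then have "2 * p \<le> fact (card S)" by (metis of_nat_fact of_nat_le_iff)
      then show False using primes[OF p(1) \<open>p dvd m\<close>] by simp
    qed
    then show ?thesis by (metis coprime_int_iff int_nat_eq abs_ge_zero coprime_abs_left_iff)
  qed
  \<comment> \<open>Since \<open>2 * t\<close> is at most 10, \<open>t\<close> itself can be taken
    for \<open>d\<close> in \<open>cop\<close>, so \<open>m\<close> and \<open>t\<close> are
    coprime.\<close>
  have "(24::int) \<le> fact (card S)"
    using fact_mono[of 4 "card S", where 'a=int] False by (simp add: fact_numeral)
  then have "coprime (int t) (int m)" using assms(1,2) by (intro cop) auto
  then have n_dvd: "int n dvd c" if "int m dvd c" "int t dvd c" for c
    using that divides_mult[of "int m" c "int t"] by (simp add: assms(3) coprime_commute)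
  \<comment> \<open>The forms compare two elements of \<open>S\<close>; as \<open>0\<close> is not
    in \<open>S\<close>, the choice \<open>b = 0\<close> gives the evaluation at \<open>a\<close>
    alone.\<close>
  define V :: "(nat \<Rightarrow> int) set" where "V = (\<lambda>(a, b) s. of_bool (s = a) - of_bool (s = b)) ` (S \<times> insert 0 S)"
  have mem: "(\<lambda>s. of_bool (s = a) - of_bool (s = b)) \<in> V" if "a \<in> S" "b \<in> insert 0 S" for a b
    unfolding V_def using that by (intro image_eqI[of _ _ "(a, b)"]) simp_all
  have V: "(\<Sum>s\<in>S. (of_bool (s = a) - of_bool (s = b)) * f s) = f a - (if b \<in> S then f b else 0)"
    if "a \<in> S" for a b and f :: "nat \<Rightarrow> int"
  proof -
    have "(\<Sum>s\<in>S. (of_bool (s = a) - of_bool (s = b)) * f s) =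
        (\<Sum>s\<in>S. (if s = a then f s else 0) - (if s = b then f s else 0))"
      by (intro sum.cong) auto
    then show ?thesis using fin that by (simp add: sum_subtractf)
  qed
  have "0 \<notin> S" using S by auto
  have "finite V" unfolding V_def using fin by simp
  obtain z where zero: "\<And>U. U \<subseteq> S \<Longrightarrow> int m dvd sum int U \<Longrightarrow> sum z U = 0"
    and zV: "\<And>v. v \<in> V \<Longrightarrow> (\<Sum>s\<in>S. v s * z s) = 0 \<Longrightarrow> int m dvd (\<Sum>s\<in>S. v s * int s)"
    using lift_combinatorial_relations[OF fin refl _ cop \<open>finite V\<close>, of int] False by auto
  have "int m dvd int a - int b" if "a \<in> S" "b \<in> S" "z a = z b" for a b
    using zV[OF mem[of a b]] that V[OF that(1), of b] by simp
  moreover have "\<not> int n dvd int a - int b" if "a \<in> S" "b \<in> S" "a \<noteq> b" for a b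
    using S that by (intro residue_diff_not_dvd) auto
  ultimately have inj: "\<not> int t dvd int a - int b" if "a \<in> S" "b \<in> S" "a \<noteq> b" "z a = z b" for a b
    using n_dvd that by blast
  have "int m dvd int a" if "a \<in> S" "z a = 0" for a
    using zV[OF mem[of a 0]] that V[OF that(1), of 0] \<open>0 \<notin> S\<close> by simp
  moreover have "\<not> int n dvd int a" if "a \<in> S" for a
    using S that nat_dvd_not_less[of a n] by (auto simp: subset_iff Suc_le_eq)
  ultimately have nz: "\<not> int t dvd int a" if "a \<in> S" "z a = 0" for a
    using n_dvd that by blast
  have weak: "\<exists>os. distinct os \<and> set os = A \<and> proper_block_free (zero_block z int (int t) 0) os"
    if "A \<subseteq> S" "\<And>a. a \<in> A \<Longrightarrow> z a = 0" for A
  proof (rule ordering_modulus_le_5)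
    show "finite A" using that(1) fin finite_subset by blast
    show "\<not> int t dvd int a - int b" if "a \<in> A" "b \<in> A" "a \<noteq> b" for a b
      using inj[of a b] that \<open>A \<subseteq> S\<close> \<open>\<And>a. a \<in> A \<Longrightarrow> z a = 0\<close> by auto
    show "\<not> int t dvd int a" if "a \<in> A" for a
      using nz[of a] that \<open>A \<subseteq> S\<close> \<open>\<And>a. a \<in> A \<Longrightarrow> z a = 0\<close> by blast
  qed (use assms(1,2) in auto)
  obtain xs where xs: "distinct xs" "set xs = S" "proper_block_free (zero_block z int (int t) 0) xs"
    using ordering_extension[OF fin inj nz weak] by blast
  have "\<not> n dvd sum_list ys" if *: "xs = as @ ys @ bs" "ys \<noteq> []" "as \<noteq> [] \<or> bs \<noteq> []" for as ys bs
  proof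
    assume "n dvd sum_list ys"
    have "distinct ys" "set ys \<subseteq> S" using * xs by auto
    have "sum_list (map int ys) = int (sum_list ys)" by (induction ys) auto
    then have dvd: "int n dvd sum_list (map int ys)" using \<open>n dvd sum_list ys\<close> by simp
    then have "int m dvd sum_list (map int ys)" "int t dvd sum_list (map int ys)"
      unfolding assms(3) by (auto elim: dvd_mult_left dvd_mult_right)
    moreover from this have "sum_list (map z ys) = 0"
      using zero[OF \<open>set ys \<subseteq> S\<close>] \<open>distinct ys\<close> by (simp add: sum_list_distinct_conv_sum_set)
    ultimately have "zero_block z int (int t) 0 ys" by (simp add: zero_block_def)
    then show False using xs(3) * unfolding proper_block_free_def by blast
  qed
  then show ?thesis using xs(1,2)
    by (intro sequenceable_if_proper_block_free[of xs]) (auto simp: proper_block_free_def)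
qed

theorem theorem1p5:
  fixes k t m n :: nat and S :: "nat set"
  assumes "k > 0" and "t > 0" and "m > 0" and "n = m * t"
    and "\<forall>p. prime p \<and> p dvd m \<longrightarrow> fact k < 2 * p"
    and "S \<subseteq> {1..<n}" and "card S = k"
    and "(k \<le> 11 \<and> t \<le> 5)
      \<or> (k = 12 \<and> t \<le> 4)
      \<or> (k = 13 \<and> t \<in> {2, 3} \<and> \<not> S \<subseteq> subgroup_of_order n m)
      \<or> (k = 14 \<and> t = 2 \<and> \<not> S \<subseteq> subgroup_of_order n m)
      \<or> (k = 15 \<and> t = 2 \<and> card (S \<inter> subgroup_of_order n m) \<notin> {0, 1, 2, 15})"
  shows "sequenceable n S"
proof -
  have "t \<le> 5" using assms(8) by auto
  then show ?thesis using sequenceable_modulus_le_5[of t n m S] assms(2,4-7) by blast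
qed

end
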